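(* Consider any sequence of mergeable-tree operations on a heap-ordered forest, starting from the empty forest, consisting of $\mathit{insert}(v)$, $\mathit{merge}(v,w)$, $\mathit{root}(v)$, $\mathit{nca}(v,w)$, and deletions of leaves (no cuts and no parent queries), and simulate it on a forest of dynamic trees as follows: $\mathit{insert}(v)$ creates a new one-node dynamic tree $v$; a leaf deletion is ignored (does nothing); $\mathit{root}(v)$ returns $\mathit{treemin}(v)$; $\mathit{nca}(v,w)$ returns null if $\mathit{treemin}(v)\neq\mathit{treemin}(w)$, and otherwise does $\mathit{evert}(v)$ and returns $\mathit{pathmin}(w)$; $\mathit{merge}(v,w)$, if $\mathit{treemin}(v)\neq\mathit{treemin}(w)$, does $\mathit{evert}(v)$ and then $\mathit{link}(v,w)$, and otherwise does $\mathit{evert}(v)$, lets $u=\mathit{pathmin}(w)$, and if $u\notin\{v,w\}$ does $\mathit{cut}(u)$ and then $\mathit{link}(v,w)$. Then this simulation is correct: every $\mathit{root}$ and $\mathit{nca}$ query returns the root, respectively the nearest common ancestor (null if in different trees), in the current mergeable forest.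
   Context: A heap-ordered forest is a set of node-disjoint rooted trees whose nodes are distinct elements of a totally ordered set, with every non-root node greater than its parent. $\mathit{merge}(v,w)$: letting $P$ and $Q$ be the paths from $v$ and $w$ to the roots of their trees, every node $z\in P\cup Q$ gets as its new parent the largest node of $P\cup Q$ smaller than $z$ (no parent if none), while all other nodes keep their parents. Dynamic trees are rooted trees (not necessarily heap-ordered) on the same node set, supporting: $\mathit{treemin}(v)$, the minimum node in the tree containing $v$; $\mathit{pathmin}(v)$, the minimum node on the path from $v$ to the root of its tree; $\mathit{evert}(v)$, which makes $v$ the root of its tree by reversing every arc on the path from $v$ to the root; $\mathit{link}(v,w)$, which makes the root $v$ a child of $w$ (in a different tree); and $\mathit{cut}(u)$, which deletes the arc from $u$ to its parent.
   Formalization: The formal theorem assumes that no node is inserted twice in the sequence: a deleted leaf is never inserted again, since the simulation ignores deletions and the node would still be present in the dynamic trees. *)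

theory Defs
  imports Main "HOL-Library.Monad_Syntax"
begin

text \<open>A forest of rooted trees. A pair \<open>(x, y)\<close> in \<open>arcs\<close> means that \<open>y\<close> is the parent of \<open>x\<close>.\<close>

record 'a forest =
  nodes :: "'a set"
  arcs :: "('a \<times> 'a) set"

definition empty_forest :: "'a forest" where
  "empty_forest = \<lparr>nodes = {}, arcs = {}\<rparr>"

definition is_root :: "'a forest \<Rightarrow> 'a \<Rightarrow> bool" where
  "is_root F r \<longleftrightarrow> r \<in> nodes F \<and> (\<forall>y. (r, y) \<notin> arcs F)"

definition is_leaf :: "'a forest \<Rightarrow> 'a \<Rightarrow> bool" where
  "is_leaf F v \<longleftrightarrow> v \<in> nodes F \<and> (\<forall>x. (x, v) \<notin> arcs F)"

text \<open>The nodes on the path from \<open>v\<close> to the root, that is, the ancestors of \<open>v\<close>, including \<open>v\<close>.\<close>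

definition root_path :: "'a forest \<Rightarrow> 'a \<Rightarrow> 'a set" where
  "root_path F v = {x. (v, x) \<in> (arcs F)\<^sup>*}"

definition root_of :: "'a forest \<Rightarrow> 'a \<Rightarrow> 'a" where
  "root_of F v = (THE r. r \<in> root_path F v \<and> is_root F r)"

definition tree_of :: "'a forest \<Rightarrow> 'a \<Rightarrow> 'a set" where
  "tree_of F v = {x \<in> nodes F. root_of F x = root_of F v}"

definition nca_of :: "'a forest \<Rightarrow> 'a \<Rightarrow> 'a \<Rightarrow> 'a" where
  "nca_of F v w =
    (THE u. u \<in> root_path F v \<inter> root_path F w \<and> root_path F v \<inter> root_path F w \<subseteq> root_path F u)"

datatype 'a oper =
    Insert 'a
  | Merge 'a 'a
  | Root 'a
  | Nca 'a 'a
  | Delete_Leaf 'a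

text \<open>\<open>Done\<close> is the result of an operation that is not a query.\<close>

datatype 'a result = Done | Null | Node 'a

definition mt_insert :: "'a \<Rightarrow> 'a forest \<Rightarrow> 'a forest" where
  "mt_insert v F = F\<lparr>nodes := insert v (nodes F)\<rparr>"

definition mt_delete :: "'a \<Rightarrow> 'a forest \<Rightarrow> 'a forest" where
  "mt_delete v F = \<lparr>nodes = nodes F - {v}, arcs = {(x, y) \<in> arcs F. x \<noteq> v}\<rparr>"

definition mt_merge :: "'a::linorder \<Rightarrow> 'a \<Rightarrow> 'a forest \<Rightarrow> 'a forest" where
  "mt_merge v w F =
    (let S = root_path F v \<union> root_path F w in
      F\<lparr>arcs := {(z, y) \<in> arcs F. z \<notin> S} \<union>
        {(z, y). z \<in> S \<and> y \<in> S \<and> y < z \<and> (\<forall>x\<in>S. x < z \<longrightarrow> x \<le> y)}\<rparr>)"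

fun mt_step :: "'a::linorder oper \<Rightarrow> 'a forest \<Rightarrow> 'a result \<times> 'a forest" where
  "mt_step (Insert v) F = (Done, mt_insert v F)"
| "mt_step (Merge v w) F = (Done, mt_merge v w F)"
| "mt_step (Root v) F = (Node (root_of F v), F)"
| "mt_step (Nca v w) F =
    (if tree_of F v \<noteq> tree_of F w then Null else Node (nca_of F v w), F)"
| "mt_step (Delete_Leaf v) F = (Done, mt_delete v F)"

fun mt_run :: "'a::linorder oper list \<Rightarrow> 'a forest \<Rightarrow> 'a result list" where
  "mt_run [] F = []"
| "mt_run (p # ps) F = (let (r, F') = mt_step p F in r # mt_run ps F')"

fun mt_permitted :: "'a oper \<Rightarrow> 'a forest \<Rightarrow> bool" where
  "mt_permitted (Insert v) F \<longleftrightarrow> v \<notin> nodes F"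
| "mt_permitted (Merge v w) F \<longleftrightarrow> v \<in> nodes F \<and> w \<in> nodes F"
| "mt_permitted (Root v) F \<longleftrightarrow> v \<in> nodes F"
| "mt_permitted (Nca v w) F \<longleftrightarrow> v \<in> nodes F \<and> w \<in> nodes F"
| "mt_permitted (Delete_Leaf v) F \<longleftrightarrow> is_leaf F v"

fun mt_legal :: "'a::linorder oper list \<Rightarrow> 'a forest \<Rightarrow> bool" where
  "mt_legal [] F \<longleftrightarrow> True"
| "mt_legal (p # ps) F \<longleftrightarrow> mt_permitted p F \<and> mt_legal ps (snd (mt_step p F))"

text \<open>Leaf deletions leave the node in the simulating forest, so a deleted node must not be inserted
  again; this is expressed by distinctness of the following list.\<close>

fun inserted :: "'a oper list \<Rightarrow> 'a list" where
  "inserted [] = []"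
| "inserted (Insert v # ps) = v # inserted ps"
| "inserted (_ # ps) = inserted ps"

text \<open>Operations with a precondition on the shape of the forest yield \<^term>\<open>None\<close> if it is violated.\<close>

definition dt_make :: "'a \<Rightarrow> 'a forest \<Rightarrow> 'a forest option" where
  "dt_make v D =
    (if v \<notin> nodes D then Some (D\<lparr>nodes := insert v (nodes D)\<rparr>) else None)"

definition dt_treemin :: "'a::linorder \<Rightarrow> 'a forest \<Rightarrow> 'a" where
  "dt_treemin v D = Min (tree_of D v)"

definition dt_pathmin :: "'a::linorder \<Rightarrow> 'a forest \<Rightarrow> 'a" where
  "dt_pathmin v D = Min (root_path D v)"

definition dt_evert :: "'a \<Rightarrow> 'a forest \<Rightarrow> 'a forest" where
  "dt_evert v D =
    (let P = {(x, y) \<in> arcs D. x \<in> root_path D v} in D\<lparr>arcs := (arcs D - P) \<union> P\<inverse>\<rparr>)"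

definition dt_link :: "'a \<Rightarrow> 'a \<Rightarrow> 'a forest \<Rightarrow> 'a forest option" where
  "dt_link v w D =
    (if is_root D v \<and> w \<in> nodes D \<and> tree_of D v \<noteq> tree_of D w
     then Some (D\<lparr>arcs := insert (v, w) (arcs D)\<rparr>) else None)"

definition dt_cut :: "'a \<Rightarrow> 'a forest \<Rightarrow> 'a forest option" where
  "dt_cut u D =
    (if u \<in> nodes D \<and> \<not> is_root D u
     then Some (D\<lparr>arcs := {(x, y) \<in> arcs D. x \<noteq> u}\<rparr>) else None)"

definition sim_merge :: "'a::linorder \<Rightarrow> 'a \<Rightarrow> 'a forest \<Rightarrow> 'a forest option" where
  "sim_merge v w D =
    (if dt_treemin v D \<noteq> dt_treemin w D
     then dt_link v w (dt_evert v D)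
     else
       let D' = dt_evert v D; u = dt_pathmin w D' in
       if u \<notin> {v, w} then do { D'' \<leftarrow> dt_cut u D'; dt_link v w D'' } else Some D')"

fun sim_step :: "'a::linorder oper \<Rightarrow> 'a forest \<Rightarrow> ('a result \<times> 'a forest) option" where
  "sim_step (Insert v) D = do { D' \<leftarrow> dt_make v D; Some (Done, D') }"
| "sim_step (Merge v w) D = do { D' \<leftarrow> sim_merge v w D; Some (Done, D') }"
| "sim_step (Root v) D = Some (Node (dt_treemin v D), D)"
| "sim_step (Nca v w) D =
    (if dt_treemin v D \<noteq> dt_treemin w D then Some (Null, D)
     else let D' = dt_evert v D in Some (Node (dt_pathmin w D'), D'))"
| "sim_step (Delete_Leaf v) D = Some (Done, D)"

fun sim_run :: "'a::linorder oper list \<Rightarrow> 'a forest \<Rightarrow> 'a result list option" where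
  "sim_run [] D = Some []"
| "sim_run (p # ps) D =
    do { (r, D') \<leftarrow> sim_step p D; rs \<leftarrow> sim_run ps D'; Some (r # rs) }"

end

theory Submission
  imports Defs
begin

text \<open>Call a forest restricted to an upward closed set \<open>U\<close> of nodes, with the directions of the arcs
  forgotten, its \<open>U\<close>-part. The nearest common ancestor of two nodes of a heap-ordered forest is the
  largest \<open>a\<close> such that they are connected in the \<open>{a..}\<close>-part, and in an unrooted tree the minimum of
  a path has the same characterisation. Hence the simulation is correct as long as the \<open>U\<close>-parts of
  both forests have the same connected components for every \<open>U\<close>. A merge of \<open>v\<close> and \<open>w\<close> changes this
  connectivity, in both forests, exactly as adding an edge between \<open>v\<close> and \<open>w\<close> does: in the dynamic
  forest, the deleted arc is incident to the minimum of the cycle that the new edge closes, so whenever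
  this arc is present in a \<open>U\<close>-part, the whole cycle is. Leaf deletions are handled by comparing with
  a heap-ordered forest in which deleted nodes are kept.\<close>

section \<open>Connectivity inside a set of nodes\<close>

text \<open>A pair \<open>(x, x)\<close> is related even for \<open>x\<close> outside
  \<open>U\<close>, which keeps reflexivity free of side conditions. A pair of distinct nodes is
  related only if both lie in \<open>U\<close>.\<close>

definition conn :: "('a \<times> 'a) set \<Rightarrow> 'a set \<Rightarrow> ('a \<times> 'a) set" where
  "conn E U = ((E \<union> E\<inverse>) \<inter> U \<times> U)\<^sup>*"

text \<open>One family covers both uses: \<open>{a..}\<close> for nearest common ancestors and path
  minima, and \<open>UNIV\<close> for membership in the same tree.\<close>

definition upward_closed :: "'a::order set \<Rightarrow> bool" where
  "upward_closed U \<longleftrightarrow> (\<forall>x\<in>U. \<forall>y. x \<le> y \<longrightarrow> y \<in> U)"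

lemma upward_closedD: "upward_closed U \<Longrightarrow> x \<in> U \<Longrightarrow> x \<le> y \<Longrightarrow> y \<in> U"
  by (auto simp: upward_closed_def)

lemma upward_closed_atLeast [simp]: "upward_closed {a..}"
  by (auto simp: upward_closed_def)

lemma upward_closed_UNIV [simp]: "upward_closed UNIV"
  by (auto simp: upward_closed_def)

lemma conn_refl [simp]: "(x, x) \<in> conn E U"
  by (simp add: conn_def)

lemma conn_arc: "(x, y) \<in> E \<Longrightarrow> x \<in> U \<Longrightarrow> y \<in> U \<Longrightarrow> (x, y) \<in> conn E U"
  by (auto simp: conn_def)

lemma conn_sym: "(x, y) \<in> conn E U \<Longrightarrow> (y, x) \<in> conn E U"
proof -
  have "sym (conn E U)"
    unfolding conn_def by (rule sym_rtrancl) (auto simp: sym_def)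
  then show "(x, y) \<in> conn E U \<Longrightarrow> (y, x) \<in> conn E U"
    by (auto simp: sym_def)
qed

lemma conn_trans: "(x, y) \<in> conn E U \<Longrightarrow> (y, z) \<in> conn E U \<Longrightarrow> (x, z) \<in> conn E U"
  by (auto simp: conn_def)

text \<open>It suffices to check single arcs, because \<open>conn E' U\<close> is already reflexive,
  symmetric and transitive.\<close>

lemma conn_subset:
  assumes "\<And>x y. (x, y) \<in> E \<Longrightarrow> x \<in> U \<Longrightarrow> y \<in> U \<Longrightarrow> (x, y) \<in> conn E' U"
  shows "conn E U \<subseteq> conn E' U"
proof -
  have "(E \<union> E\<inverse>) \<inter> U \<times> U \<subseteq> conn E' U"
    using assms by (auto intro: conn_sym)
  then have "conn E U \<subseteq> (conn E' U)\<^sup>*"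
    unfolding conn_def[of E] by (rule rtrancl_mono)
  then show ?thesis
    by (simp add: conn_def)
qed

text \<open>This transfers the addition of the merge edge from the dynamic forest to the mergeable
  one, although their arcs differ.\<close>

lemma conn_insert_cong:
  assumes "conn E U = conn E' U"
  shows "conn (insert e E) U = conn (insert e E') U"
proof -
  have mono: "conn E U \<subseteq> conn (insert e E) U" for E
    by (rule conn_subset) (auto intro: conn_arc)
  have "conn (insert e E) U \<subseteq> conn (insert e E') U" if "conn E U = conn E' U" for E E'
  proof (rule conn_subset)
    fix x y
    assume "(x, y) \<in> insert e E" "x \<in> U" "y \<in> U"
    then show "(x, y) \<in> conn (insert e E') U"
      using that mono[of E'] conn_arc[of x y E U] conn_arc[of x y "insert e E'" U] by auto
  qed
  then show ?thesis
    using assms by blast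
qed

lemma conn_insert_redundant:
  assumes "v \<in> U \<Longrightarrow> w \<in> U \<Longrightarrow> (v, w) \<in> conn E U"
  shows "conn (insert (v, w) E) U = conn E U"
proof
  show "conn (insert (v, w) E) U \<subseteq> conn E U"
    by (rule conn_subset) (use assms in \<open>auto intro: conn_arc\<close>)
  show "conn E U \<subseteq> conn (insert (v, w) E) U"
    by (rule conn_subset) (auto intro: conn_arc)
qed

text \<open>The hypothesis on \<open>z\<close> has the form that order bounds supply: in a heap
  every node between \<open>x\<close> and \<open>y\<close> is at least \<open>y\<close>, and in a
  dynamic tree it is at least the path minimum.\<close>

lemma rtrancl_conn:
  assumes "(x, y) \<in> E\<^sup>*" and "\<And>z. (x, z) \<in> E\<^sup>* \<Longrightarrow> (z, y) \<in> E\<^sup>* \<Longrightarrow> z \<in> U"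
  shows "(x, y) \<in> conn E U"
  using assms
proof (induction rule: converse_rtrancl_induct)
  case (step x z)
  have "(z, y) \<in> conn E U"
    using step by (meson converse_rtrancl_into_rtrancl)
  moreover have "(x, z) \<in> conn E U"
  proof (rule conn_arc)
    show "x \<in> U" "z \<in> U"
      using step.hyps step.prems by (meson converse_rtrancl_into_rtrancl r_into_rtrancl rtrancl_refl)+
  qed (rule step.hyps)
  ultimately show ?case
    by (blast intro: conn_trans)
qed simp


section \<open>Rooted forests\<close>

text \<open>Acyclicity is encoded by the last clause: with unique parents, a node that reaches a
  root cannot lie on a cycle.\<close>

definition rooted_forest :: "'a forest \<Rightarrow> bool" where
  "rooted_forest F \<longleftrightarrow> finite (nodes F) \<and> arcs F \<subseteq> nodes F \<times> nodes F \<and> single_valued (arcs F) \<and>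
    (\<forall>x\<in>nodes F. \<exists>r. (x, r) \<in> (arcs F)\<^sup>* \<and> is_root F r)"

lemma rooted_forest_rtrancl_in_nodes:
  assumes "rooted_forest F" "x \<in> nodes F" "(x, y) \<in> (arcs F)\<^sup>*"
  shows "y \<in> nodes F"
  using assms(3,2) by (induction) (use assms(1) in \<open>auto simp: rooted_forest_def\<close>)

text \<open>A root lies on no cycle, and if a node lies on a cycle then so does its unique parent.
  Hence no node that reaches a root lies on one.\<close>

lemma rooted_forest_acyclic:
  assumes F: "rooted_forest F"
  shows "(x, x) \<notin> (arcs F)\<^sup>+"
proof
  assume cyc: "(x, x) \<in> (arcs F)\<^sup>+"
  then have "x \<in> nodes F"
    using F by (auto simp: rooted_forest_def dest: tranclD)
  then obtain r where r: "(x, r) \<in> (arcs F)\<^sup>*" "is_root F r"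
    using F by (auto simp: rooted_forest_def)
  from r(1) have "(x, x) \<notin> (arcs F)\<^sup>+"
  proof (induction rule: converse_rtrancl_induct)
    case base
    then show ?case
      using r(2) by (auto simp: is_root_def dest: tranclD)
  next
    case (step x y)
    show ?case
    proof
      assume "(x, x) \<in> (arcs F)\<^sup>+"
      then obtain z where z: "(x, z) \<in> arcs F" "(z, x) \<in> (arcs F)\<^sup>*"
        by (auto dest: tranclD)
      then have "z = y"
        using F step(1) by (auto simp: rooted_forest_def single_valued_def)
      then show False
        using z step by (meson rtrancl_into_trancl1)
    qed
  qed
  then show False
    using cyc by blast
qed

lemma rooted_forest_antisym:
  assumes "rooted_forest F" "(x, y) \<in> (arcs F)\<^sup>*" "(y, x) \<in> (arcs F)\<^sup>*"
  shows "x = y"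
  using assms rooted_forest_acyclic[OF assms(1)]
  by (metis rtranclD trancl_trans)

lemma rooted_forest_linear:
  assumes "rooted_forest F" "(x, y) \<in> (arcs F)\<^sup>*" "(x, z) \<in> (arcs F)\<^sup>*"
  shows "(y, z) \<in> (arcs F)\<^sup>* \<or> (z, y) \<in> (arcs F)\<^sup>*"
  using assms single_valued_confluent unfolding rooted_forest_def by metis

lemma is_root_rtrancl: "is_root F r \<Longrightarrow> (r, x) \<in> (arcs F)\<^sup>* \<Longrightarrow> x = r"
  by (metis converse_rtranclE is_root_def)

lemma root_of_eqI:
  assumes "rooted_forest F" "(x, r) \<in> (arcs F)\<^sup>*" "is_root F r"
  shows "root_of F x = r"
  unfolding root_of_def root_path_def
proof (rule the_equality)
  fix s
  assume "s \<in> {y. (x, y) \<in> (arcs F)\<^sup>*} \<and> is_root F s"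
  then show "s = r"
    using assms rooted_forest_linear[OF assms(1,2), of s] is_root_rtrancl by fastforce
qed (use assms in auto)

lemma
  assumes "rooted_forest F" "x \<in> nodes F"
  shows root_of_reachable: "(x, root_of F x) \<in> (arcs F)\<^sup>*"
    and is_root_root_of: "is_root F (root_of F x)"
proof -
  obtain r where "(x, r) \<in> (arcs F)\<^sup>*" "is_root F r"
    using assms unfolding rooted_forest_def by metis
  with root_of_eqI[OF assms(1) this]
  show "(x, root_of F x) \<in> (arcs F)\<^sup>*" "is_root F (root_of F x)"
    by simp_all
qed

lemma root_of_arc:
  assumes F: "rooted_forest F" and "(x, y) \<in> arcs F"
  shows "root_of F x = root_of F y"
proof (rule root_of_eqI[OF F])
  have y: "y \<in> nodes F"
    using assms by (auto simp: rooted_forest_def)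
  show "(x, root_of F y) \<in> (arcs F)\<^sup>*"
    using root_of_reachable[OF F y] assms(2) by simp
  show "is_root F (root_of F y)"
    by (rule is_root_root_of[OF F y])
qed

lemma root_of_conn:
  assumes F: "rooted_forest F" and "(x, y) \<in> conn (arcs F) U"
  shows "root_of F x = root_of F y"
  using assms(2) unfolding conn_def
proof (induction rule: rtrancl_induct)
  case (step y z)
  then show ?case
    using root_of_arc[OF F] by force
qed simp

lemma root_of_eq_iff_conn:
  assumes F: "rooted_forest F" and "x \<in> nodes F" "y \<in> nodes F"
  shows "root_of F x = root_of F y \<longleftrightarrow> (x, y) \<in> conn (arcs F) UNIV"
proof
  have "(z, root_of F z) \<in> conn (arcs F) UNIV" if "z \<in> nodes F" for z
    by (rule rtrancl_conn) (use root_of_reachable[OF F that] in auto)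
  then show "root_of F x = root_of F y \<Longrightarrow> (x, y) \<in> conn (arcs F) UNIV"
    using assms by (metis conn_sym conn_trans)
qed (use root_of_conn[OF F] in blast)

lemma tree_of_eq_iff: "v \<in> nodes F \<Longrightarrow> tree_of F v = tree_of F w \<longleftrightarrow> root_of F v = root_of F w"
  by (auto simp: tree_of_def)

lemma tree_of_eq_conn:
  assumes "rooted_forest F" "v \<in> nodes F"
  shows "tree_of F v = {x \<in> nodes F. (x, v) \<in> conn (arcs F) UNIV}"
  using root_of_eq_iff_conn[OF assms(1) _ assms(2)] by (auto simp: tree_of_def)

text \<open>In a forest the tree path between two nodes is contained in every walk between them.\<close>

lemma conn_root_path_subset:
  assumes F: "rooted_forest F" and r: "is_root F r" and "r \<in> U" and "(r, x) \<in> conn (arcs F) U"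
  shows "root_path F x \<subseteq> U"
  using assms(4) unfolding conn_def
proof (induction rule: rtrancl_induct)
  case base
  then show ?case
    using assms is_root_rtrancl[OF r] by (auto simp: root_path_def)
next
  case (step y z)
  \<comment> \<open>A step up shortens the path to the root. A step down adds one node to it, the
    node \<open>z\<close> that the walk has just entered.\<close>
  then consider "(y, z) \<in> arcs F" | "(z, y) \<in> arcs F" "z \<in> U"
    by auto
  then show ?case
  proof cases
    case 1
    then show ?thesis
      using step.IH by (auto simp: root_path_def)
  next
    case 2
    show ?thesis
    proof
      fix t
      assume "t \<in> root_path F z"
      then have "(z, t) \<in> (arcs F)\<^sup>*"
        by (simp add: root_path_def)
      then show "t \<in> U"
      proof (cases rule: converse_rtranclE)
        case (step z')
        then have "z' = y"
          using 2 F by (auto simp: rooted_forest_def single_valued_def)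
        then show ?thesis
          using step \<open>root_path F y \<subseteq> U\<close> by (auto simp: root_path_def)
      qed (use 2 in auto)
    qed
  qed
qed

lemma finite_root_path: "rooted_forest F \<Longrightarrow> x \<in> nodes F \<Longrightarrow> finite (root_path F x)"
  by (rule finite_subset[of _ "nodes F"])
    (auto simp: root_path_def rooted_forest_rtrancl_in_nodes, simp add: rooted_forest_def)


section \<open>Operations on dynamic trees\<close>

lemma nodes_dt_evert [simp]: "nodes (dt_evert v D) = nodes D"
  by (simp add: dt_evert_def Let_def)

lemma conn_dt_evert [simp]: "conn (arcs (dt_evert v D)) U = conn (arcs D) U"
proof -
  have "arcs (dt_evert v D) \<union> (arcs (dt_evert v D))\<inverse> = arcs D \<union> (arcs D)\<inverse>"
    by (auto simp: dt_evert_def Let_def)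
  then show ?thesis
    by (simp add: conn_def)
qed

text \<open>The reversed path leads from each of its nodes to \<open>v\<close>. A node off the path
  climbs as before until it meets the path or an old root.\<close>

lemma
  assumes D: "rooted_forest D" and v: "v \<in> nodes D"
  shows is_root_dt_evert: "is_root (dt_evert v D) v"
    and rooted_forest_dt_evert: "rooted_forest (dt_evert v D)"
proof -
  define P where "P = {(x, y) \<in> arcs D. x \<in> root_path D v}"
  define D' where "D' = dt_evert v D"
  have arcs: "arcs D' = (arcs D - P) \<union> P\<inverse>" and nodes: "nodes D' = nodes D"
    by (simp_all add: D'_def dt_evert_def P_def Let_def)
  have P: "x \<in> root_path D v" "y \<in> root_path D v" "(x, y) \<in> arcs D" if "(x, y) \<in> P" for x y
    using that by (auto simp: P_def root_path_def)
  have root: "is_root D' v"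
  proof -
    have "(v, y) \<in> P" if "(v, y) \<in> arcs D" for y
      using that by (auto simp: P_def root_path_def)
    moreover have "(x, v) \<notin> P" for x
    proof
      assume "(x, v) \<in> P"
      then have "(v, v) \<in> (arcs D)\<^sup>+"
        by (auto simp: P_def root_path_def)
      then show False
        using rooted_forest_acyclic[OF D] by blast
    qed
    ultimately show ?thesis
      using v by (auto simp: is_root_def arcs nodes)
  qed
  have path: "(x, v) \<in> (arcs D')\<^sup>*" if "x \<in> root_path D v" for x
  proof -
    from that have "(v, x) \<in> (arcs D)\<^sup>*"
      by (simp add: root_path_def)
    then show ?thesis
    proof (induction rule: rtrancl_induct)
      case (step y z)
      then have "(z, y) \<in> arcs D'"
        by (auto simp: arcs P_def root_path_def)
      then show ?case
        using step.IH by simp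
    qed simp
  qed
  have "\<exists>r. (x, r) \<in> (arcs D')\<^sup>* \<and> is_root D' r" if "x \<in> nodes D" for x
  proof -
    from root_of_reachable[OF D that] is_root_root_of[OF D that]
    obtain r where "(x, r) \<in> (arcs D)\<^sup>*" "is_root D r"
      by metis
    then show ?thesis
    proof (induction rule: converse_rtrancl_induct)
      case base
      show ?case
      proof (cases "r \<in> root_path D v")
        case True
        then show ?thesis
          using path root by blast
      next
        case False
        then have "is_root D' r"
          using base P by (auto simp: is_root_def arcs nodes)
        then show ?thesis
          by blast
      qed
    next
      case (step x y)
      show ?case
      proof (cases "x \<in> root_path D v")
        case True
        then show ?thesis
          using path root by blast
      next
        case False
        then have "(x, y) \<in> arcs D'"
          using step P by (auto simp: arcs)
        then show ?thesis
          using step by (meson converse_rtrancl_into_rtrancl)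
      qed
    qed
  qed
  moreover have "single_valued (arcs D')"
  proof -
    have sv: "single_valued (arcs D)"
      using D by (simp add: rooted_forest_def)
    \<comment> \<open>Both sources lie on the path from \<open>v\<close>, so one reaches the other.
      If they differed, the first would do so through \<open>z\<close>, and the arc from the second
      back to \<open>z\<close> would close a cycle.\<close>
    have rev: "a = b" if ab: "(a, z) \<in> P" "(b, z) \<in> P" for a b z
    proof -
      have *: "a = b" if "(a, b) \<in> (arcs D)\<^sup>*" "(a, z) \<in> arcs D" "(b, z) \<in> arcs D" for a b
        using that(1)
      proof (cases rule: converse_rtranclE)
        case (step y)
        then have "(z, b) \<in> (arcs D)\<^sup>*"
          using that sv by (auto simp: single_valued_def)
        then have "(z, z) \<in> (arcs D)\<^sup>+"
          using that by (meson rtrancl_into_trancl1)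
        then show ?thesis
          using rooted_forest_acyclic[OF D] by blast
      qed
      have "(v, a) \<in> (arcs D)\<^sup>*" "(v, b) \<in> (arcs D)\<^sup>*"
        using ab P by (auto simp: root_path_def)
      then show ?thesis
        using rooted_forest_linear[OF D, of v a b] * ab P by metis
    qed
    \<comment> \<open>Kept arcs start off the path and reversed arcs start on it, so the two kinds
      never give a node two parents.\<close>
    have keep: "z \<notin> root_path D v" if "(z, a) \<in> arcs D - P" for z a
      using that by (auto simp: P_def)
    show ?thesis
      unfolding single_valued_def arcs
      using sv rev keep P(2) by (auto simp: single_valued_def) (metis DiffI)+
  qed
  moreover have "finite (nodes D')" "arcs D' \<subseteq> nodes D' \<times> nodes D'"
    using D by (auto simp: rooted_forest_def arcs nodes P_def)
  ultimately show "rooted_forest (dt_evert v D)"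
    by (simp add: rooted_forest_def nodes flip: D'_def)
  show "is_root (dt_evert v D) v"
    using root by (simp add: D'_def)
qed

lemma dt_link_Some:
  assumes D: "rooted_forest D" and v: "is_root D v" and w: "w \<in> nodes D" and "root_of D w \<noteq> v"
  shows "dt_link v w D = Some (D\<lparr>arcs := insert (v, w) (arcs D)\<rparr>)"
    and "rooted_forest (D\<lparr>arcs := insert (v, w) (arcs D)\<rparr>)"
proof -
  have vn: "v \<in> nodes D"
    using v by (simp add: is_root_def)
  have "root_of D v = v"
    by (rule root_of_eqI[OF D _ v]) simp
  then show "dt_link v w D = Some (D\<lparr>arcs := insert (v, w) (arcs D)\<rparr>)"
    using assms vn by (auto simp: dt_link_def tree_of_eq_iff)
  define D' where "D' = D\<lparr>arcs := insert (v, w) (arcs D)\<rparr>"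
  have sub: "(arcs D)\<^sup>* \<subseteq> (arcs D')\<^sup>*"
    by (rule rtrancl_mono) (auto simp: D'_def)
  have root: "is_root D' r" if "is_root D r" "r \<noteq> v" for r
    using that by (auto simp: is_root_def D'_def)
  have "\<exists>r. (x, r) \<in> (arcs D')\<^sup>* \<and> is_root D' r" if x: "x \<in> nodes D" for x
  proof (cases "root_of D x = v")
    case True
    then have "(x, v) \<in> (arcs D')\<^sup>*"
      using root_of_reachable[OF D x] sub by auto
    moreover have "(v, w) \<in> arcs D'"
      by (simp add: D'_def)
    moreover have "(w, root_of D w) \<in> (arcs D')\<^sup>*"
      using root_of_reachable[OF D w] sub by auto
    ultimately have "(x, root_of D w) \<in> (arcs D')\<^sup>*"
      by (meson rtrancl.rtrancl_into_rtrancl rtrancl_trans)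
    then show ?thesis
      using root is_root_root_of[OF D w] assms(4) by blast
  next
    case False
    then show ?thesis
      using root_of_reachable[OF D x] is_root_root_of[OF D x] sub root by blast
  qed
  then have "rooted_forest D'"
    using D v w vn by (auto simp: rooted_forest_def is_root_def single_valued_def D'_def)
  then show "rooted_forest (D\<lparr>arcs := insert (v, w) (arcs D)\<rparr>)"
    by (simp add: D'_def)
qed

lemma rooted_forest_cut:
  assumes D: "rooted_forest D"
  shows "rooted_forest (D\<lparr>arcs := {(x, y) \<in> arcs D. x \<noteq> u}\<rparr>)" (is "rooted_forest ?D")
proof -
  have "\<exists>r. (x, r) \<in> (arcs ?D)\<^sup>* \<and> is_root ?D r" if x: "x \<in> nodes D" for x
  proof -
    from root_of_reachable[OF D that] is_root_root_of[OF D that]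
    obtain r where "(x, r) \<in> (arcs D)\<^sup>*" "is_root D r"
      by metis
    then show ?thesis
    proof (induction rule: converse_rtrancl_induct)
      case base
      then have "is_root ?D r"
        by (auto simp: is_root_def)
      then show ?case
        by blast
    next
      case (step x y)
      show ?case
      proof (cases "x = u")
        case True
        then have "is_root ?D x"
          using step D by (auto simp: is_root_def rooted_forest_def)
        then show ?thesis
          by blast
      next
        case False
        then have "(x, y) \<in> arcs ?D"
          using step by auto
        then show ?thesis
          using step by (meson converse_rtrancl_into_rtrancl)
      qed
    qed
  qed
  then show ?thesis
    using D by (auto simp: rooted_forest_def single_valued_def)
qed

text \<open>A path to \<open>u\<close> can be stopped at its first visit to \<open>u\<close>, before
  an arc out of \<open>u\<close> is used.\<close>

lemma rtrancl_cut:
  assumes "(x, u) \<in> E\<^sup>*"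
  shows "(x, u) \<in> {(a, b) \<in> E. a \<noteq> u}\<^sup>*"
  using assms
proof (induction rule: converse_rtrancl_induct)
  case (step x y)
  then show ?case
    by (cases "x = u") (auto intro: converse_rtrancl_into_rtrancl)
qed simp

lemma rtrancl_avoid:
  assumes "(x, y) \<in> E\<^sup>*" "(x, u) \<notin> E\<^sup>*"
  shows "(x, y) \<in> {(a, b) \<in> E. a \<noteq> u}\<^sup>*"
  using assms
proof (induction rule: rtrancl_induct)
  case (step y z)
  then have "(y, z) \<in> {(a, b) \<in> E. a \<noteq> u}"
    by auto
  then show ?case
    using step by (meson rtrancl.rtrancl_into_rtrancl)
qed simp

lemma conn_cut_link:
  assumes D: "rooted_forest D" and v: "is_root D v" and wv: "(w, v) \<in> (arcs D)\<^sup>*"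
    and wu: "(w, u) \<in> (arcs D)\<^sup>*"
    and min: "\<And>x. (w, x) \<in> (arcs D)\<^sup>* \<Longrightarrow> u \<le> x" and U: "upward_closed U"
  shows "conn (insert (v, w) {(x, y) \<in> arcs D. x \<noteq> u}) U = conn (insert (v, w) (arcs D)) U"
    (is "conn (insert _ ?C) U = _")
proof
  show "conn (insert (v, w) ?C) U \<subseteq> conn (insert (v, w) (arcs D)) U"
    by (rule conn_subset) (auto intro: conn_arc)
  show "conn (insert (v, w) (arcs D)) U \<subseteq> conn (insert (v, w) ?C) U"
  proof (rule conn_subset)
    fix x y
    assume xy: "(x, y) \<in> insert (v, w) (arcs D)" "x \<in> U" "y \<in> U"
    let ?E = "insert (v, w) ?C"
    show "(x, y) \<in> conn ?E U"
    proof (cases "(x, y) \<in> ?E")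
      case True
      then show ?thesis
        using xy by (auto intro: conn_arc)
    next
      case False
      \<comment> \<open>Only the deleted arc from \<open>u\<close> to \<open>y\<close> needs a
        detour: from \<open>y\<close> up to \<open>v\<close>, over the new edge to \<open>w\<close>,
        and up to \<open>u\<close>. As \<open>u\<close> is minimal on the path and lies in
        \<open>U\<close>, the detour stays in \<open>U\<close>.\<close>
      then have x: "x = u" and uy: "(u, y) \<in> arcs D"
        using xy by auto
      have inU: "z \<in> U" if "(w, z) \<in> (arcs D)\<^sup>*" for z
        using min[OF that] U x xy(2) by (auto intro: upward_closedD)
      have sub: "?C\<^sup>* \<subseteq> (arcs D)\<^sup>*"
        by (rule rtrancl_mono) auto
      have mono: "conn ?C U \<subseteq> conn ?E U"
        by (rule conn_subset) (auto intro: conn_arc)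
      have "(w, u) \<in> conn ?C U"
        by (rule rtrancl_conn[OF rtrancl_cut[OF wu]]) (use sub inU in blast)
      moreover have "(v, w) \<in> conn ?E U"
        by (rule conn_arc) (use inU wv in auto)
      moreover have "(y, v) \<in> conn ?C U"
      proof (rule rtrancl_conn)
        have wy: "(w, y) \<in> (arcs D)\<^sup>*"
          using wu uy by simp
        have "(y, v) \<in> (arcs D)\<^sup>*"
          using rooted_forest_linear[OF D wy wv] is_root_rtrancl[OF v] by auto
        \<comment> \<open>Otherwise the arc from \<open>u\<close> to \<open>y\<close> would close a
          cycle. So the path from \<open>y\<close> to \<open>v\<close> avoids \<open>u\<close> and
          survives the cut.\<close>
        moreover have "(y, u) \<notin> (arcs D)\<^sup>*"
          using rooted_forest_acyclic[OF D, of u] uy by (meson rtrancl_into_trancl2)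
        ultimately show "(y, v) \<in> ?C\<^sup>*"
          by (rule rtrancl_avoid)
        show "z \<in> U" if "(y, z) \<in> ?C\<^sup>*" for z
          using that sub wy inU by (meson rtrancl_trans subsetD)
      qed
      ultimately have "(y, u) \<in> conn ?E U"
        using mono by (meson conn_trans subsetD)
      then show ?thesis
        using x by (auto intro: conn_sym)
    qed
  qed
qed


section \<open>Heap-ordered forests\<close>

definition heap_forest :: "'a::linorder forest \<Rightarrow> bool" where
  "heap_forest F \<longleftrightarrow> finite (nodes F) \<and> arcs F \<subseteq> nodes F \<times> nodes F \<and> single_valued (arcs F) \<and>
    (\<forall>(x, y)\<in>arcs F. y < x)"

lemma heap_forest_le:
  assumes "heap_forest F" "(x, y) \<in> (arcs F)\<^sup>*"
  shows "y \<le> x"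
  using assms(2) by induction (use assms(1) in \<open>fastforce simp: heap_forest_def\<close>)+

text \<open>The minimum of the finite set \<open>root_path F x\<close> is a root, since its parent
  would be a smaller member.\<close>

lemma rooted_forest_if_heap_forest:
  assumes F: "heap_forest F"
  shows "rooted_forest F"
proof -
  have "\<exists>r. (x, r) \<in> (arcs F)\<^sup>* \<and> is_root F r" if x: "x \<in> nodes F" for x
  proof -
    have sub: "root_path F x \<subseteq> nodes F"
    proof
      fix y
      assume "y \<in> root_path F x"
      then have "(x, y) \<in> (arcs F)\<^sup>*"
        by (simp add: root_path_def)
      then show "y \<in> nodes F"
        by induction (use x F in \<open>auto simp: heap_forest_def\<close>)
    qed
    then have fin: "finite (root_path F x)"
      using F by (auto simp: heap_forest_def intro: finite_subset)
    have ne: "root_path F x \<noteq> {}"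
      by (auto simp: root_path_def)
    let ?r = "Min (root_path F x)"
    have r: "?r \<in> root_path F x"
      using fin ne by (rule Min_in)
    have "(?r, y) \<notin> arcs F" for y
    proof
      assume "(?r, y) \<in> arcs F"
      then have "y < ?r" "y \<in> root_path F x"
        using F r by (auto simp: heap_forest_def root_path_def)
      then show False
        using fin by (meson Min_le leD)
    qed
    then show ?thesis
      using r sub by (auto simp: is_root_def root_path_def)
  qed
  then show ?thesis
    using F by (auto simp: heap_forest_def rooted_forest_def)
qed

lemma Min_tree_of_heap_forest:
  assumes F: "heap_forest F" and v: "v \<in> nodes F"
  shows "Min (tree_of F v) = root_of F v"
proof (rule Min_eqI)
  have F': "rooted_forest F"
    by (rule rooted_forest_if_heap_forest[OF F])
  show "finite (tree_of F v)"
    using F by (auto simp: tree_of_def heap_forest_def)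
  show "root_of F v \<le> y" if "y \<in> tree_of F v" for y
    using that heap_forest_le[OF F root_of_reachable[OF F', of y]] by (auto simp: tree_of_def)
  have "is_root F (root_of F v)"
    by (rule is_root_root_of[OF F' v])
  then show "root_of F v \<in> tree_of F v"
    using root_of_eqI[OF F', of "root_of F v" "root_of F v"] by (auto simp: tree_of_def is_root_def)
qed

text \<open>Induct along the walk, maintaining a common ancestor \<open>c\<close> in
  \<open>U\<close>. A step down keeps \<open>c\<close>. A step up from \<open>y\<close> to
  \<open>z\<close> keeps it too, unless \<open>c = y\<close>, and then \<open>z\<close> takes
  over.\<close>

lemma conn_common_ancestor:
  assumes F: "rooted_forest F" and "(v, x) \<in> conn (arcs F) U" and "v \<in> U"
  shows "\<exists>c\<in>U. (v, c) \<in> (arcs F)\<^sup>* \<and> (x, c) \<in> (arcs F)\<^sup>*"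
  using assms(2) unfolding conn_def
proof (induction rule: rtrancl_induct)
  case base
  then show ?case
    using \<open>v \<in> U\<close> by blast
next
  case (step y z)
  then obtain c where c: "c \<in> U" "(v, c) \<in> (arcs F)\<^sup>*" "(y, c) \<in> (arcs F)\<^sup>*"
    by blast
  from step consider "(y, z) \<in> arcs F" "z \<in> U" | "(z, y) \<in> arcs F"
    by auto
  then show ?case
  proof cases
    case 1
    from c(3) show ?thesis
    proof (cases rule: converse_rtranclE)
      case base
      then show ?thesis
        using 1 c by (meson rtrancl.rtrancl_into_rtrancl rtrancl.rtrancl_refl)
    next
      case (step y')
      then have "y' = z"
        using 1 F by (auto simp: rooted_forest_def single_valued_def)
      then show ?thesis
        using step c by blast
    qed
  next
    case 2
    then show ?thesis
      using c by (meson converse_rtrancl_into_rtrancl)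
  qed
qed

lemma heap_forest_ancestor_conn:
  assumes "heap_forest F" "(x, c) \<in> (arcs F)\<^sup>*" "c \<in> U" "upward_closed U"
  shows "(x, c) \<in> conn (arcs F) U"
  using assms(2) by (rule rtrancl_conn) (rule upward_closedD[OF assms(4,3) heap_forest_le[OF assms(1)]])

text \<open>All ancestors of \<open>v\<close> form a chain that decreases towards the root, so the
  common ancestor below all others in the tree is the largest one in the order.\<close>

lemma nca_of_eqI:
  assumes F: "heap_forest F" and m: "m \<in> root_path F v \<inter> root_path F w"
    and max: "\<And>c. c \<in> root_path F v \<inter> root_path F w \<Longrightarrow> c \<le> m"
  shows "nca_of F v w = m"
  unfolding nca_of_def
proof (rule the_equality)
  have F': "rooted_forest F"
    by (rule rooted_forest_if_heap_forest[OF F])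
  have sub: "c \<in> root_path F m" if c: "c \<in> root_path F v \<inter> root_path F w" for c
    using rooted_forest_linear[OF F', of v m c] c m max[OF c] heap_forest_le[OF F, of c m]
    by (auto simp: root_path_def)
  show "m \<in> root_path F v \<inter> root_path F w \<and> root_path F v \<inter> root_path F w \<subseteq> root_path F m"
    using m sub by blast
  fix u
  assume u: "u \<in> root_path F v \<inter> root_path F w \<and> root_path F v \<inter> root_path F w \<subseteq> root_path F u"
  then have "m \<in> root_path F u" "u \<in> root_path F m"
    using m sub by blast+
  then show "u = m"
    using rooted_forest_antisym[OF F', of u m] by (simp add: root_path_def)
qed

section \<open>The effect of a merge on heap order and connectivity\<close>

lemma nodes_mt_merge [simp]: "nodes (mt_merge v w F) = nodes F"
  by (simp add: mt_merge_def Let_def)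

lemma arcs_mt_merge:
  "arcs (mt_merge v w F) = {(z, y) \<in> arcs F. z \<notin> root_path F v \<union> root_path F w} \<union>
    {(z, y). z \<in> root_path F v \<union> root_path F w \<and> y \<in> root_path F v \<union> root_path F w \<and> y < z \<and>
      (\<forall>x\<in>root_path F v \<union> root_path F w. x < z \<longrightarrow> x \<le> y)}"
  by (simp add: mt_merge_def Let_def)

lemma heap_forest_mt_merge:
  assumes F: "heap_forest F" and "v \<in> nodes F" "w \<in> nodes F"
  shows "heap_forest (mt_merge v w F)"
proof -
  define S where "S = root_path F v \<union> root_path F w"
  have S: "S \<subseteq> nodes F"
    using assms rooted_forest_rtrancl_in_nodes[OF rooted_forest_if_heap_forest[OF F]]
    by (auto simp: S_def root_path_def)
  have "single_valued (arcs (mt_merge v w F))"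
    using F unfolding arcs_mt_merge S_def[symmetric]
    by (auto simp: heap_forest_def single_valued_def intro!: antisym)
  then show ?thesis
    using F S unfolding heap_forest_def arcs_mt_merge S_def[symmetric] by auto
qed

text \<open>Descend from \<open>z\<close> to \<open>y\<close> through successive predecessors in
  \<open>S\<close>. All nodes visited are at least \<open>y\<close>, hence in \<open>U\<close>. The
  induction is on the number of elements of \<open>S\<close> below \<open>z\<close>.\<close>

lemma conn_pred_chain:
  fixes S :: "'a::linorder set"
  assumes S: "finite S" and U: "upward_closed U"
    and E: "\<And>y z. y \<in> S \<Longrightarrow> z \<in> S \<Longrightarrow> y < z \<Longrightarrow> (\<forall>x\<in>S. x < z \<longrightarrow> x \<le> y) \<Longrightarrow> (z, y) \<in> E"
    and "y \<in> S" "y \<in> U" "z \<in> S" "y \<le> z"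
  shows "(z, y) \<in> conn E U"
  using \<open>z \<in> S\<close> \<open>y \<le> z\<close>
proof (induction "card {x \<in> S. x < z}" arbitrary: z rule: less_induct)
  case less
  show ?case
  proof (cases "y = z")
    case False
    define p where "p = Max {x \<in> S. x < z}"
    have fin: "finite {x \<in> S. x < z}"
      using S by simp
    have y: "y \<in> {x \<in> S. x < z}"
      using False less.prems \<open>y \<in> S\<close> by simp
    have p: "p \<in> S" "p < z"
      using Max_in[OF fin] y unfolding p_def by blast+
    have le: "x \<le> p" if "x \<in> S" "x < z" for x
      using that fin unfolding p_def by simp
    have "card {x \<in> S. x < p} < card {x \<in> S. x < z}"
      by (rule psubset_card_mono[OF fin]) (use p in auto)
    then have "(p, y) \<in> conn E U"
      using less.hyps p(1) le y by blast
    moreover have "(z, p) \<in> conn E U"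
      by (rule conn_arc[OF E])
        (use p le y less.prems upward_closedD[OF U \<open>y \<in> U\<close>] in auto)
    ultimately show ?thesis
      by (blast intro: conn_trans)
  qed simp
qed

lemma conn_mt_merge:
  assumes F: "heap_forest F" and v: "v \<in> nodes F" and w: "w \<in> nodes F" and U: "upward_closed U"
  shows "conn (arcs (mt_merge v w F)) U = conn (insert (v, w) (arcs F)) U"
    (is "conn ?M U = conn ?I U")
proof
  define S where "S = root_path F v \<union> root_path F w"
  have M: "?M = {(z, y) \<in> arcs F. z \<notin> S} \<union>
      {(z, y). z \<in> S \<and> y \<in> S \<and> y < z \<and> (\<forall>x\<in>S. x < z \<longrightarrow> x \<le> y)}"
    unfolding arcs_mt_merge S_def ..
  have vw: "v \<in> S" "w \<in> S"
    by (auto simp: S_def root_path_def)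
  have mono: "conn (arcs F) U \<subseteq> conn ?I U"
    by (rule conn_subset) (auto intro: conn_arc)
  show "conn ?M U \<subseteq> conn ?I U"
  proof (rule conn_subset)
    fix z y
    assume zy: "(z, y) \<in> ?M" "z \<in> U" "y \<in> U"
    \<comment> \<open>A node of a merged path is an ancestor of \<open>v\<close> or
      \<open>w\<close>. That descendant is at least as large, so it and the path from it lie in
      \<open>U\<close>.\<close>
    have S_conn: "\<exists>s\<in>{v, w} \<inter> U. (s, x) \<in> conn ?I U" if x: "x \<in> S" "x \<in> U" for x
    proof -
      obtain s where s: "s \<in> {v, w}" "(s, x) \<in> (arcs F)\<^sup>*"
        using x by (auto simp: S_def root_path_def)
      then have "s \<in> U"
        using heap_forest_le[OF F s(2)] U x(2) by (auto intro: upward_closedD)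
      moreover have "(s, x) \<in> conn ?I U"
        using heap_forest_ancestor_conn[OF F s(2) x(2) U] mono by blast
      ultimately show ?thesis
        using s(1) by blast
    qed
    show "(z, y) \<in> conn ?I U"
    proof (cases "z \<in> S")
      case True
      then have "y \<in> S"
        using zy(1) unfolding M by blast
      then obtain s t where s: "s \<in> {v, w}" "s \<in> U" "(s, z) \<in> conn ?I U"
        and t: "t \<in> {v, w}" "t \<in> U" "(t, y) \<in> conn ?I U"
        using S_conn True zy by blast
      \<comment> \<open>If \<open>s\<close> and \<open>t\<close> differ, they are \<open>v\<close>
        and \<open>w\<close>, both in \<open>U\<close>, and the added edge joins them.\<close>
      have "(s, t) \<in> conn ?I U"
        using s(1,2) t(1,2) conn_arc[of v w ?I U] conn_sym[of v w ?I U] by auto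
      then show ?thesis
        using s(3) t(3) by (meson conn_sym conn_trans)
    next
      case False
      then have "(z, y) \<in> ?I"
        using zy(1) unfolding M by blast
      then show ?thesis
        using zy(2,3) by (rule conn_arc)
    qed
  qed
  show "conn ?I U \<subseteq> conn ?M U"
  proof (rule conn_subset)
    fix z y
    assume zy: "(z, y) \<in> ?I" "z \<in> U" "y \<in> U"
    have fin: "finite S"
      using finite_root_path[OF rooted_forest_if_heap_forest[OF F]] v w by (simp add: S_def)
    have chain: "(b, a) \<in> conn ?M U" if "a \<in> S" "b \<in> S" "a \<in> U" "a \<le> b" for a b
      by (rule conn_pred_chain[OF fin U]) (use that in \<open>auto simp: M\<close>)
    show "(z, y) \<in> conn ?M U"
    proof (cases "z \<in> S")
      case True
      \<comment> \<open>\<open>S\<close> is closed under parents and contains both ends of the added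
        edge.\<close>
      then have "y \<in> S"
        using zy(1) vw by (auto simp: S_def root_path_def intro: rtrancl.rtrancl_into_rtrancl)
      then show ?thesis
        using chain[of y z] chain[of z y] True zy(2,3) by (meson conn_sym linear)
    next
      case False
      then have "(z, y) \<in> ?M"
        using zy(1) vw unfolding M by blast
      then show ?thesis
        using zy(2,3) by (rule conn_arc)
    qed
  qed
qed


section \<open>Removing leaves\<close>

text \<open>The two conditions on arcs make \<open>nodes F\<close> closed under parents in
  \<open>G\<close>, with every node of \<open>F\<close> keeping its parent. Paths to the root
  therefore agree in \<open>F\<close> and \<open>G\<close>.\<close>

definition subforest :: "'a forest \<Rightarrow> 'a forest \<Rightarrow> bool" where
  "subforest F G \<longleftrightarrow> nodes F \<subseteq> nodes G \<and> arcs F = {(x, y) \<in> arcs G. x \<in> nodes F} \<and>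
    arcs F \<subseteq> nodes F \<times> nodes F"

lemma subforest_parent: "subforest F G \<Longrightarrow> (x, y) \<in> arcs G \<Longrightarrow> x \<in> nodes F \<Longrightarrow> y \<in> nodes F"
  unfolding subforest_def by blast

lemma subforest_root_path:
  assumes FG: "subforest F G" and "x \<in> nodes F"
  shows "root_path F x = root_path G x" and "root_path F x \<subseteq> nodes F"
proof -
  have sub: "(arcs F)\<^sup>* \<subseteq> (arcs G)\<^sup>*"
    by (rule rtrancl_mono) (use FG in \<open>auto simp: subforest_def\<close>)
  have "(x, y) \<in> (arcs F)\<^sup>* \<and> y \<in> nodes F" if "(x, y) \<in> (arcs G)\<^sup>*" for y
    using that
  proof (induction rule: rtrancl_induct)
    case (step y z)
    then have "(y, z) \<in> arcs F"
      using FG by (auto simp: subforest_def)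
    moreover have "z \<in> nodes F"
      using subforest_parent[OF FG] step by blast
    ultimately show ?case
      using step.IH by (meson rtrancl.rtrancl_into_rtrancl)
  qed (use assms in auto)
  then show "root_path F x = root_path G x" "root_path F x \<subseteq> nodes F"
    using sub by (auto simp: root_path_def)
qed

lemma subforest_root_of:
  assumes FG: "subforest F G" and x: "x \<in> nodes F"
  shows "root_of F x = root_of G x"
proof -
  have "is_root F r \<longleftrightarrow> is_root G r" if "r \<in> root_path F x" for r
    using that FG subforest_root_path(2)[OF assms] by (auto simp: is_root_def subforest_def)
  then have "r \<in> root_path F x \<and> is_root F r \<longleftrightarrow> r \<in> root_path G x \<and> is_root G r" for r
    using subforest_root_path(1)[OF assms] by auto
  then show ?thesis
    by (simp add: root_of_def)
qed

lemma subforest_nca_of: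
  assumes FG: "subforest F G" and x: "v \<in> nodes F" "w \<in> nodes F"
  shows "nca_of F v w = nca_of G v w"
proof -
  have "root_path F u = root_path G u" if "u \<in> root_path G v" for u
    using that subforest_root_path[OF FG x(1)] subforest_root_path(1)[OF FG, of u] by auto
  then have "u \<in> root_path F v \<inter> root_path F w \<and> root_path F v \<inter> root_path F w \<subseteq> root_path F u \<longleftrightarrow>
      u \<in> root_path G v \<inter> root_path G w \<and> root_path G v \<inter> root_path G w \<subseteq> root_path G u" for u
    using subforest_root_path(1)[OF FG] x by auto
  then show ?thesis
    by (simp add: nca_of_def)
qed

text \<open>\<open>v\<close> is a leaf of \<open>F\<close>, so no remaining node has it as parent.
  In \<open>G\<close> it may still have children, deleted earlier.\<close>

lemma subforest_mt_delete: "subforest F G \<Longrightarrow> is_leaf F v \<Longrightarrow> subforest (mt_delete v F) G"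
  unfolding subforest_def is_leaf_def mt_delete_def by (simp, blast)

text \<open>Freshness is required in \<open>G\<close>: a node deleted from \<open>F\<close> may
  still have a parent in \<open>G\<close>.\<close>

lemma subforest_mt_insert:
  "subforest F G \<Longrightarrow> heap_forest G \<Longrightarrow> v \<notin> nodes G \<Longrightarrow> subforest (mt_insert v F) (mt_insert v G)"
  by (auto simp: subforest_def heap_forest_def mt_insert_def)

lemma subforest_mt_merge:
  assumes FG: "subforest F G" and v: "v \<in> nodes F" and w: "w \<in> nodes F"
  shows "subforest (mt_merge v w F) (mt_merge v w G)"
proof -
  define S where "S = root_path F v \<union> root_path F w"
  have S: "S = root_path G v \<union> root_path G w" "S \<subseteq> nodes F"
    using subforest_root_path[OF FG] v w by (auto simp: S_def)
  show ?thesis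
    using FG S(2) subforest_parent[OF FG] unfolding subforest_def arcs_mt_merge nodes_mt_merge S(1)[symmetric] S_def[symmetric]
    by auto
qed


section \<open>The simulation\<close>

text \<open>\<open>G\<close> is the mergeable forest as it would be without the leaf deletions.\<close>

definition simulates :: "'a::linorder forest \<Rightarrow> 'a forest \<Rightarrow> 'a forest \<Rightarrow> bool" where
  "simulates D G F \<longleftrightarrow> subforest F G \<and> heap_forest G \<and> rooted_forest D \<and> nodes D = nodes G \<and>
    (\<forall>U. upward_closed U \<longrightarrow> conn (arcs D) U = conn (arcs G) U)"

lemma simulates_empty: "simulates empty_forest empty_forest empty_forest"
  by (auto simp: simulates_def subforest_def heap_forest_def rooted_forest_def empty_forest_def)

lemma simulates_dt_evert:
  "simulates D G F \<Longrightarrow> v \<in> nodes F \<Longrightarrow> simulates (dt_evert v D) G F"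
  by (auto simp: simulates_def subforest_def intro: rooted_forest_dt_evert)

text \<open>Connectivity for \<open>UNIV\<close> gives \<open>v\<close> the same tree in
  \<open>D\<close> and \<open>G\<close>, as a set of nodes. In the heap-ordered \<open>G\<close> its
  minimum is the root, and \<open>F\<close> has the same root.\<close>

lemma dt_treemin_eq_root_of:
  assumes sim: "simulates D G F" and v: "v \<in> nodes F"
  shows "dt_treemin v D = root_of F v"
proof -
  have FG: "subforest F G" and G: "heap_forest G" and D: "rooted_forest D"
    and n: "nodes D = nodes G" and c: "conn (arcs D) UNIV = conn (arcs G) UNIV"
    using sim by (simp_all add: simulates_def)
  have v': "v \<in> nodes G"
    using FG v by (auto simp: subforest_def)
  have "tree_of D v = tree_of G v"
    using tree_of_eq_conn[OF D, of v] tree_of_eq_conn[OF rooted_forest_if_heap_forest[OF G] v'] v' n c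
    by simp
  then show ?thesis
    using Min_tree_of_heap_forest[OF G v'] subforest_root_of[OF FG v] by (simp add: dt_treemin_def)
qed

lemma simulates_root_of_eq_iff:
  assumes sim: "simulates D G F" and v: "v \<in> nodes F" and w: "w \<in> nodes F"
  shows "root_of F v = root_of F w \<longleftrightarrow> root_of D v = root_of D w"
proof -
  have FG: "subforest F G" and G: "heap_forest G" and D: "rooted_forest D"
    and n: "nodes D = nodes G" and c: "conn (arcs D) UNIV = conn (arcs G) UNIV"
    using sim by (simp_all add: simulates_def)
  have "v \<in> nodes G" "w \<in> nodes G"
    using FG v w by (auto simp: subforest_def)
  then show ?thesis
    using root_of_eq_iff_conn[OF D, of v w] c n subforest_root_of[OF FG] v w
      root_of_eq_iff_conn[OF rooted_forest_if_heap_forest[OF G], of v w] by simp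
qed

text \<open>After everting, the root path of \<open>w\<close> is exactly the tree path between
  \<open>w\<close> and \<open>v\<close>.\<close>

lemma evert_path:
  assumes sim: "simulates D G F" and v: "v \<in> nodes F" and w: "w \<in> nodes F"
    and same: "root_of F v = root_of F w"
  shows "(w, v) \<in> (arcs (dt_evert v D))\<^sup>*"
proof -
  let ?D = "dt_evert v D"
  have sim': "simulates ?D G F"
    by (rule simulates_dt_evert[OF sim v])
  then have D': "rooted_forest ?D" and w': "w \<in> nodes ?D"
    using w by (auto simp: simulates_def subforest_def)
  have "is_root ?D v"
    by (rule is_root_dt_evert) (use sim v in \<open>auto simp: simulates_def subforest_def\<close>)
  then have "root_of ?D v = v"
    using root_of_eqI[OF D', of v v] by simp
  then show ?thesis
    using root_of_reachable[OF D' w'] simulates_root_of_eq_iff[OF sim' v w] same by simp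
qed

lemma dt_pathmin_evert_eq_nca_of:
  assumes sim: "simulates D G F" and v: "v \<in> nodes F" and w: "w \<in> nodes F"
    and same: "root_of F v = root_of F w"
  shows "dt_pathmin w (dt_evert v D) = nca_of F v w"
proof -
  let ?D = "dt_evert v D"
  have sim': "simulates ?D G F"
    by (rule simulates_dt_evert[OF sim v])
  then have D': "rooted_forest ?D" and w': "w \<in> nodes ?D" and FG: "subforest F G"
    and G: "heap_forest G" and c: "\<And>U. upward_closed U \<Longrightarrow> conn (arcs ?D) U = conn (arcs G) U"
    using w by (auto simp: simulates_def subforest_def)
  have root: "is_root ?D v"
    by (rule is_root_dt_evert) (use sim v in \<open>auto simp: simulates_def subforest_def\<close>)
  have wv: "(w, v) \<in> (arcs ?D)\<^sup>*"
    by (rule evert_path[OF assms])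
  define m where "m = Min (root_path ?D w)"
  have fin: "finite (root_path ?D w)"
    by (rule finite_root_path[OF D' w'])
  have le: "m \<le> x" if "(w, x) \<in> (arcs ?D)\<^sup>*" for x
    using that fin by (simp add: m_def root_path_def)
  have "m \<in> root_path ?D w"
    unfolding m_def by (rule Min_in[OF fin]) (auto simp: root_path_def)
  \<comment> \<open>The tree path lies in \<open>{m..}\<close>, so in \<open>G\<close> some common
    ancestor is at least \<open>m\<close>.\<close>
  have "(w, v) \<in> conn (arcs ?D) {m..}"
    by (rule rtrancl_conn[OF wv]) (use le in auto)
  then have "(v, w) \<in> conn (arcs G) {m..}"
    using c by (auto intro: conn_sym)
  then obtain a where a: "m \<le> a" "(v, a) \<in> (arcs G)\<^sup>*" "(w, a) \<in> (arcs G)\<^sup>*"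
    using conn_common_ancestor[OF rooted_forest_if_heap_forest[OF G], of v w "{m..}"] le[OF wv]
    by auto
  \<comment> \<open>A common ancestor \<open>b\<close> connects \<open>v\<close> and
    \<open>w\<close> inside \<open>{b..}\<close>. The tree path of the dynamic forest then lies in
    \<open>{b..}\<close> as well, and so does its minimum \<open>m\<close>.\<close>
  have max: "b \<le> m" if "b \<in> root_path G v \<inter> root_path G w" for b
  proof -
    have b: "(v, b) \<in> (arcs G)\<^sup>*" "(w, b) \<in> (arcs G)\<^sup>*"
      using that by (auto simp: root_path_def)
    have "(v, b) \<in> conn (arcs G) {b..}" "(w, b) \<in> conn (arcs G) {b..}"
      using b by (auto intro: heap_forest_ancestor_conn[OF G])
    then have "(v, w) \<in> conn (arcs ?D) {b..}"
      using c[of "{b..}"] by (metis conn_sym conn_trans upward_closed_atLeast)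
    then have "root_path ?D w \<subseteq> {b..}"
      using conn_root_path_subset[OF D' root] heap_forest_le[OF G b(1)] by auto
    then show ?thesis
      using \<open>m \<in> root_path ?D w\<close> by auto
  qed
  \<comment> \<open>The two bounds force \<open>a = m\<close>.\<close>
  have "m \<in> root_path G v \<inter> root_path G w"
    using a max[of a] by (auto simp: root_path_def)
  then have "nca_of G v w = m"
    using max by (rule nca_of_eqI[OF G])
  then show ?thesis
    using subforest_nca_of[OF FG v w] by (simp add: m_def dt_pathmin_def)
qed

text \<open>Every branch of \<open>sim_merge\<close> is thereby reduced to one obligation: its
  effect on connectivity is that of adding an edge between \<open>v\<close> and
  \<open>w\<close>.\<close>

lemma simulates_mt_mergeI:
  assumes sim: "simulates D G F" and v: "v \<in> nodes F" and w: "w \<in> nodes F"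
    and D': "rooted_forest D'" "nodes D' = nodes D"
      "\<And>U. upward_closed U \<Longrightarrow> conn (arcs D') U = conn (insert (v, w) (arcs D)) U"
  shows "simulates D' (mt_merge v w G) (mt_merge v w F)"
proof -
  have FG: "subforest F G" and G: "heap_forest G"
    and n: "nodes D = nodes G" and c: "\<And>U. upward_closed U \<Longrightarrow> conn (arcs D) U = conn (arcs G) U"
    using sim by (simp_all add: simulates_def)
  have vw: "v \<in> nodes G" "w \<in> nodes G"
    using FG v w by (auto simp: subforest_def)
  have "conn (arcs D') U = conn (arcs (mt_merge v w G)) U" if U: "upward_closed U" for U
    using D'(3)[OF U] conn_insert_cong[OF c[OF U], of "(v, w)"] conn_mt_merge[OF G vw U] by simp
  then show ?thesis
    using D'(1,2) n subforest_mt_merge[OF FG v w] heap_forest_mt_merge[OF G vw]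
    by (simp add: simulates_def)
qed

text \<open>The result \<open>Some D'\<close> includes that the preconditions of
  \<open>dt_link\<close> and \<open>dt_cut\<close> hold whenever these operations are
  called.\<close>

lemma sim_merge_simulates:
  assumes sim: "simulates D G F" and v: "v \<in> nodes F" and w: "w \<in> nodes F"
  shows "\<exists>D'. sim_merge v w D = Some D' \<and> nodes D' = nodes D \<and>
    simulates D' (mt_merge v w G) (mt_merge v w F)"
proof -
  define E where "E = dt_evert v D"
  have simE: "simulates E G F"
    unfolding E_def by (rule simulates_dt_evert[OF sim v])
  have nE: "nodes E = nodes D" and cE: "\<And>U. conn (arcs E) U = conn (arcs D) U"
    by (simp_all add: E_def)
  have E: "rooted_forest E" and vE: "v \<in> nodes E" and wE: "w \<in> nodes E"
    using simE v w by (auto simp: simulates_def subforest_def)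
  have root: "is_root E v"
    unfolding E_def by (rule is_root_dt_evert) (use sim v in \<open>auto simp: simulates_def subforest_def\<close>)
  have rv: "root_of E v = v"
    by (rule root_of_eqI[OF E _ root]) simp
  show ?thesis
  proof (cases "root_of F v = root_of F w")
    case False
    then have "root_of E w \<noteq> v"
      using simulates_root_of_eq_iff[OF simE v w] rv by auto
    note link = dt_link_Some[OF E root wE this]
    have "sim_merge v w D = Some (E\<lparr>arcs := insert (v, w) (arcs E)\<rparr>)"
      using False link(1) dt_treemin_eq_root_of[OF sim] v w by (simp add: sim_merge_def E_def)
    moreover have "simulates (E\<lparr>arcs := insert (v, w) (arcs E)\<rparr>) (mt_merge v w G) (mt_merge v w F)"
      by (rule simulates_mt_mergeI[OF simE v w link(2)]) auto
    ultimately show ?thesis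
      by (simp add: nE)
  next
    case True
    have wv: "(w, v) \<in> (arcs E)\<^sup>*"
      unfolding E_def by (rule evert_path[OF sim v w True])
    define u where "u = dt_pathmin w E"
    have fin: "finite (root_path E w)"
      by (rule finite_root_path[OF E wE])
    have min: "u \<le> x" if "(w, x) \<in> (arcs E)\<^sup>*" for x
      using that fin by (simp add: u_def dt_pathmin_def root_path_def)
    have "u \<in> root_path E w"
      unfolding u_def dt_pathmin_def by (rule Min_in[OF fin]) (auto simp: root_path_def)
    then have wu: "(w, u) \<in> (arcs E)\<^sup>*"
      by (simp add: root_path_def)
    have step: "sim_merge v w D =
        (if u \<notin> {v, w} then do { D'' \<leftarrow> dt_cut u E; dt_link v w D'' } else Some E)"
      using True dt_treemin_eq_root_of[OF sim] v w by (simp add: sim_merge_def E_def u_def Let_def)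
    show ?thesis
    proof (cases "u \<in> {v, w}")
      case uvw: True
      \<comment> \<open>Here one of \<open>v\<close> and \<open>w\<close> is an ancestor of the
        other. If both lie in \<open>U\<close>, so does the path minimum and with it the whole path,
        so the edge adds no connection.\<close>
      have "simulates E (mt_merge v w G) (mt_merge v w F)"
      proof (rule simulates_mt_mergeI[OF simE v w E])
        fix U :: "'a set"
        assume U: "upward_closed U"
        have "(v, w) \<in> conn (arcs E) U" if "v \<in> U" "w \<in> U"
        proof -
          have "u \<in> U"
            using uvw that by blast
          then have "z \<in> U" if "(w, z) \<in> (arcs E)\<^sup>*" for z
            using upward_closedD[OF U _ min[OF that]] by blast
          then have "(w, v) \<in> conn (arcs E) U"
            by (rule rtrancl_conn[OF wv])
          then show ?thesis
            by (rule conn_sym)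
        qed
        then show "conn (arcs E) U = conn (insert (v, w) (arcs E)) U"
          by (rule conn_insert_redundant[symmetric])
      qed simp
      then show ?thesis
        using step uvw nE by auto
    next
      case uvw: False
      let ?C = "E\<lparr>arcs := {(x, y) \<in> arcs E. x \<noteq> u}\<rparr>"
      have C: "rooted_forest ?C"
        by (rule rooted_forest_cut[OF E])
      have un: "u \<in> nodes E"
        using rooted_forest_rtrancl_in_nodes[OF E wE wu] .
      \<comment> \<open>The path from \<open>w\<close> contains only one root, namely
        \<open>v\<close>, and \<open>u\<close> differs from it.\<close>
      have "\<not> is_root E u"
        using root_of_eqI[OF E wu] root_of_eqI[OF E wv root] uvw by auto
      then have cut: "dt_cut u E = Some ?C"
        using un by (simp add: dt_cut_def)
      have rootC: "is_root ?C v"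
        using root by (auto simp: is_root_def)
      \<comment> \<open>The cut leaves \<open>w\<close> in a tree rooted at \<open>u\<close>, away
        from the root \<open>v\<close>, so the link is allowed.\<close>
      have "root_of ?C w = u"
      proof (rule root_of_eqI[OF C])
        show "(w, u) \<in> (arcs ?C)\<^sup>*"
          using rtrancl_cut[OF wu] by simp
        show "is_root ?C u"
          using un by (simp add: is_root_def)
      qed
      then have "root_of ?C w \<noteq> v"
        using uvw by simp
      note link = dt_link_Some[OF C rootC _ this]
      have "simulates (?C\<lparr>arcs := insert (v, w) (arcs ?C)\<rparr>) (mt_merge v w G) (mt_merge v w F)"
        by (rule simulates_mt_mergeI[OF simE v w link(2)])
          (use wE conn_cut_link[OF E root wv wu min] in auto)
      moreover have "sim_merge v w D = Some (?C\<lparr>arcs := insert (v, w) (arcs ?C)\<rparr>)"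
        using step uvw cut link(1) wE by simp
      ultimately show ?thesis
        by (simp add: nE)
    qed
  qed
qed

text \<open>The node set is tracked because freshness refers to \<open>D\<close>, which retains
  deleted nodes.\<close>

lemma sim_step_simulates:
  assumes sim: "simulates D G F" and perm: "mt_permitted p F"
    and fresh: "set (inserted [p]) \<inter> nodes D = {}"
  shows "\<exists>D' G'. sim_step p D = Some (fst (mt_step p F), D') \<and>
    nodes D' = nodes D \<union> set (inserted [p]) \<and> simulates D' G' (snd (mt_step p F))"
proof (cases p)
  case (Insert v)
  let ?D = "D\<lparr>nodes := insert v (nodes D)\<rparr>"
  have v: "v \<notin> nodes D"
    using fresh Insert by simp
  have "simulates ?D (mt_insert v G) (mt_insert v F)"
  proof -
    have D: "rooted_forest D" and G: "heap_forest G" and n: "nodes D = nodes G"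
      using sim by (simp_all add: simulates_def)
    have "is_root ?D r" if "is_root D r" for r
      using that by (auto simp: is_root_def)
    moreover have "is_root ?D v"
      using v D by (auto simp: is_root_def rooted_forest_def)
    ultimately have "rooted_forest ?D"
      using D unfolding rooted_forest_def by (auto, blast+)
    moreover have "heap_forest (mt_insert v G)"
      using G by (auto simp: heap_forest_def mt_insert_def)
    ultimately show ?thesis
      using sim v n subforest_mt_insert[of F G v] by (auto simp: simulates_def mt_insert_def)
  qed
  then show ?thesis
    using v Insert by (auto simp: dt_make_def)
next
  case (Merge v w)
  then show ?thesis
    using sim_merge_simulates[OF sim, of v w] perm by fastforce
next
  case (Root v)
  then show ?thesis
    using sim perm dt_treemin_eq_root_of[OF sim] by auto
next
  case (Nca v w)
  then have v: "v \<in> nodes F" and w: "w \<in> nodes F"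
    using perm by auto
  show ?thesis
  proof (cases "root_of F v = root_of F w")
    case True
    then show ?thesis
      using Nca simulates_dt_evert[OF sim v] dt_pathmin_evert_eq_nca_of[OF sim v w]
        dt_treemin_eq_root_of[OF sim] v w tree_of_eq_iff[of v F w] by (auto simp: Let_def)
  next
    case False
    then show ?thesis
      using Nca sim dt_treemin_eq_root_of[OF sim] v w tree_of_eq_iff[of v F w] by auto
  qed
next
  case (Delete_Leaf v)
  \<comment> \<open>Only \<open>F\<close> shrinks; \<open>D\<close> and \<open>G\<close> stay as
    they are.\<close>
  then have "simulates D G (mt_delete v F)"
    using sim perm subforest_mt_delete by (auto simp: simulates_def)
  then show ?thesis
    using Delete_Leaf by auto
qed

lemma inserted_Cons: "inserted (p # ps) = inserted [p] @ inserted ps"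
  by (cases p) auto

lemma sim_run_eq_mt_run:
  assumes "simulates D G F" "mt_legal ps F" "distinct (inserted ps)"
    "set (inserted ps) \<inter> nodes D = {}"
  shows "sim_run ps D = Some (mt_run ps F)"
  using assms
proof (induction ps arbitrary: D G F)
  case (Cons p ps)
  note ins = inserted_Cons[of p ps]
  have "set (inserted [p]) \<inter> nodes D = {}"
    using Cons.prems(4) unfolding ins by auto
  then obtain D' G' where D': "sim_step p D = Some (fst (mt_step p F), D')"
    "nodes D' = nodes D \<union> set (inserted [p])" "simulates D' G' (snd (mt_step p F))"
    using sim_step_simulates[OF Cons.prems(1), of p] Cons.prems(2) by auto
  have "sim_run ps D' = Some (mt_run ps (snd (mt_step p F)))"
  proof (rule Cons.IH[OF D'(3)])
    show "mt_legal ps (snd (mt_step p F))"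
      using Cons.prems(2) by simp
    show "distinct (inserted ps)" "set (inserted ps) \<inter> nodes D' = {}"
      using Cons.prems(3,4) D'(2) unfolding ins by auto
  qed
  then show ?case
    using D'(1) by (simp add: case_prod_unfold Let_def)
qed simp

theorem theorem2:
  fixes ops :: "'a::linorder oper list"
  assumes "mt_legal ops empty_forest"
    and "distinct (inserted ops)"
  shows "sim_run ops empty_forest = Some (mt_run ops empty_forest)"
  using sim_run_eq_mt_run[OF simulates_empty assms] by (simp add: empty_forest_def)

end
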